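(* In the natural deduction system $\mathsf{CD}$, for all formulas $A,B$, first-order variables $\alpha$ and proof terms $t$: 1. If $\mathsf{CD}\vdash t:\exists\alpha\,A$ and $t$ is in normal form, then $t=(m,u)$ for some first-order term $m$ and proof term $u$, and $\mathsf{CD}\vdash u:A[m/\alpha]$. 2. If $\mathsf{CD}\vdash t:A\lor B$ and $t$ is in normal form, then either $t=\iota_0(u)$ and $\mathsf{CD}\vdash u:A$, or $t=\iota_1(u)$ and $\mathsf{CD}\vdash u:B$, for some proof term $u$. 3. If $\mathsf{CD}\vdash t:\forall\alpha\,A$ and $t$ is in normal form, then $t=\lambda\alpha\,u$ for some proof term $u$, and $\mathsf{CD}\vdash u:A$.
   Context: **Language $\mathcal{L}$ of $\mathsf{CD}$.** First-order terms are variables $\alpha,\beta,\dots$, constants $\mathsf{c}$, and expressions $\mathsf{f}(m_1,\dots,m_n)$ with $\mathsf{f}$ an $n$-ary function constant and $m_1,\dots,m_n$ terms. There is a countable set of predicate symbols, including a $0$-ary symbol $\bot$ (falsity). Atomic formulas are $\mathcal{P}(m_1,\dots,m_n)$ with $\mathcal{P}$ an $n$-ary predicate symbol. Formulas are built from atomic formulas with $\lor,\land,\rightarrow,\forall,\exists$; $\lnot A$ abbreviates $A\rightarrow\bot$. A constant $\mathsf{0}$ of $\mathcal{L}$ is fixed. **Typing rules of $\mathsf{CD}$** (natural deduction with proof terms; proof-term variables $x^A$ carry their type $A$; square-bracketed assumptions are discharged; terms are considered up to renaming of bound variables and substitution is capture-avoiding). - Axiom: $x^A : A$. - Conjunction: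 from $u:A$ and $t:B$ infer $\langle u,t\rangle : A\wedge B$; from $u:A\wedge B$ infer $u\,\pi_0 : A$ and $u\,\pi_1 : B$. - Implication: from $t:A\rightarrow B$ and $u:A$ infer $t\,u:B$; from $u:B$ infer $\lambda x^A u : A\rightarrow B$ (binding $x^A$, discharging $[x^A:A]$). - Disjunction: from $u:A$ infer $\iota_0(u):A\lor B$; from $u:B$ infer $\iota_1(u):A\lor B$; from $u:A\lor B$, $w_1:C$ and $w_2:C$ infer $u\,[x^A.w_1,\,y^B.w_2] : C$ (binding $x^A$ in $w_1$ and $y^B$ in $w_2$). - Universal quantifier: from $u:\forall\alpha\,A$ infer $u\,m : A[m/\alpha]$ for any term $m$ of $\mathcal{L}$; from $u:A$ infer $\lambda\alpha\,u:\forall\alpha\,A$, provided $\alpha$ does not occur free in the type $B$ of any free variable $x^B$ of $u$. - Existential quantifier: from $u:A[m/\alpha]$ infer $(m,u):\exists\alpha\,A$; from $u:\exists\alpha\,A$ and $t:C$ infer $u\,[(\alpha,x^A).t]:C$ (binding $\alpha$ and $x^A$ in $t$), provided $\alpha$ is not free in $C$ nor in the type $B$ of any free variable of $t$ other than $x^A$. - Constant domain axiom: for each formula $I=\forall\alpha(A\lor B)\rightarrow \forall\alpha A\lor B$ with $\alpha$ not occurring in $B$, a constant $\mathcal{D}^I : I$ (also written $\mathcal{D}$). - Ex falso: from $u:\bot$ infer $\mathsf{efq}_P\,u : P$, with $P$ atomic. The notation $\mathsf{CD}\vdash t:A$ means that $t:A$ is derivable without assumptions, i.e. $t$ has type $A$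 and has no free proof-term variables (free first-order variables are allowed). **Reduction rules.** $(\lambda x.u)t\mapsto u[t/x]$; $(\lambda\alpha.u)m\mapsto u[m/\alpha]$; $\langle u_0,u_1\rangle\pi_i\mapsto u_i$ for $i=0,1$; $\iota_i(u)[x_0.t_0,x_1.t_1]\mapsto t_i[u/x_i]$ for $i=0,1$; $(m,u)[(\alpha,x).v]\mapsto v[m/\alpha][u/x]$ for each term $m$ of $\mathcal{L}$; $\mathcal{D}(\lambda\alpha\,\iota_0(u))\mapsto\iota_0(\lambda\alpha\,u)$; $\mathcal{D}(\lambda\alpha\,\iota_1(u))\mapsto\iota_1(u[\mathsf{0}/\alpha])$. For arbitrary proof terms, $t\mapsto u$ holds whenever $u$ is obtained from $t$ by applying one reduction rule to a subterm of $t$. A proof term $t$ is in normal form if there is no $u$ with $t\mapsto u$. *)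

theory Defs
  imports Main "HOL-Library.Countable"
begin

text \<open>
  Syntax is in de Bruijn form, so that terms differing only in the names of bound variables are
  equal. Proof terms have two independent families of indices, one for first-order variables and
  one for proof-term variables. An index that points beyond all enclosing binders is a
  free variable.
\<close>

text \<open>The types \<open>'f\<close> and \<open>'p\<close> are the sets of function and predicate symbols; individual constants
  are the function symbols of arity 0. The fields \<open>falsum\<close> and \<open>zero\<close> are the distinguished
  predicate symbol \<open>\<bottom>\<close> and the distinguished constant \<open>0\<close>.\<close>

record ('f, 'p) lang =
  farity :: "'f \<Rightarrow> nat"
  parity :: "'p \<Rightarrow> nat"
  falsum :: 'p
  zero :: 'f

definition language :: "('f, 'p) lang \<Rightarrow> bool" where
  "language L \<longleftrightarrow> parity L (falsum L) = 0 \<and> farity L (zero L) = 0"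

datatype 'f trm = Var nat | Fn 'f "'f trm list"

datatype ('f, 'p) fm =
    Atom 'p "'f trm list"
  | Or "('f, 'p) fm" "('f, 'p) fm"
  | And "('f, 'p) fm" "('f, 'p) fm"
  | Imp "('f, 'p) fm" "('f, 'p) fm"
  | Forall "('f, 'p) fm"
  | Exists "('f, 'p) fm"

fun wf_trm :: "('f, 'p) lang \<Rightarrow> 'f trm \<Rightarrow> bool" where
  "wf_trm L (Var n) \<longleftrightarrow> True"
| "wf_trm L (Fn f ms) \<longleftrightarrow> length ms = farity L f \<and> (\<forall>m\<in>set ms. wf_trm L m)"

fun wf_fm :: "('f, 'p) lang \<Rightarrow> ('f, 'p) fm \<Rightarrow> bool" where
  "wf_fm L (Atom p ms) \<longleftrightarrow> length ms = parity L p \<and> (\<forall>m\<in>set ms. wf_trm L m)"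
| "wf_fm L (Or A B) \<longleftrightarrow> wf_fm L A \<and> wf_fm L B"
| "wf_fm L (And A B) \<longleftrightarrow> wf_fm L A \<and> wf_fm L B"
| "wf_fm L (Imp A B) \<longleftrightarrow> wf_fm L A \<and> wf_fm L B"
| "wf_fm L (Forall A) \<longleftrightarrow> wf_fm L A"
| "wf_fm L (Exists A) \<longleftrightarrow> wf_fm L A"

abbreviation Falsum :: "('f, 'p) lang \<Rightarrow> ('f, 'p) fm" where
  "Falsum L \<equiv> Atom (falsum L) []"

abbreviation Zero :: "('f, 'p) lang \<Rightarrow> 'f trm" where
  "Zero L \<equiv> Fn (zero L) []"

fun subst_trm :: "(nat \<Rightarrow> 'f trm) \<Rightarrow> 'f trm \<Rightarrow> 'f trm" where
  "subst_trm \<sigma> (Var n) = \<sigma> n"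
| "subst_trm \<sigma> (Fn f ms) = Fn f (map (subst_trm \<sigma>) ms)"

definition shift :: "nat \<Rightarrow> 'f trm" where
  "shift n = Var (Suc n)"

definition inst :: "'f trm \<Rightarrow> nat \<Rightarrow> 'f trm" where
  "inst m n = (case n of 0 \<Rightarrow> m | Suc k \<Rightarrow> Var k)"

definition up :: "(nat \<Rightarrow> 'f trm) \<Rightarrow> nat \<Rightarrow> 'f trm" where
  "up \<sigma> n = (case n of 0 \<Rightarrow> Var 0 | Suc k \<Rightarrow> subst_trm shift (\<sigma> k))"

fun subst_fm :: "(nat \<Rightarrow> 'f trm) \<Rightarrow> ('f, 'p) fm \<Rightarrow> ('f, 'p) fm" where
  "subst_fm \<sigma> (Atom p ms) = Atom p (map (subst_trm \<sigma>) ms)"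
| "subst_fm \<sigma> (Or A B) = Or (subst_fm \<sigma> A) (subst_fm \<sigma> B)"
| "subst_fm \<sigma> (And A B) = And (subst_fm \<sigma> A) (subst_fm \<sigma> B)"
| "subst_fm \<sigma> (Imp A B) = Imp (subst_fm \<sigma> A) (subst_fm \<sigma> B)"
| "subst_fm \<sigma> (Forall A) = Forall (subst_fm (up \<sigma>) A)"
| "subst_fm \<sigma> (Exists A) = Exists (subst_fm (up \<sigma>) A)"

text \<open>If \<open>A\<close> is the body of \<open>\<forall>\<alpha> A\<close> or \<open>\<exists>\<alpha> A\<close>, then \<open>inst_fm m A\<close> is \<open>A[m/\<alpha>]\<close>. The formulas
  in which \<open>\<alpha>\<close> (index 0) is not free are exactly those of the form \<open>shift_fm B\<close>.\<close>

abbreviation inst_fm :: "'f trm \<Rightarrow> ('f, 'p) fm \<Rightarrow> ('f, 'p) fm" where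
  "inst_fm m A \<equiv> subst_fm (inst m) A"

abbreviation shift_fm :: "('f, 'p) fm \<Rightarrow> ('f, 'p) fm" where
  "shift_fm A \<equiv> subst_fm shift A"

text \<open>
  Correspondence with the usual notation:
  \<^item> \<open>Proj0 u\<close>, \<open>Proj1 u\<close>: \<open>u \<pi>\<^sub>0\<close>, \<open>u \<pi>\<^sub>1\<close>;
  \<^item> \<open>Lam A u\<close>: \<open>\<lambda>x\<^sup>A u\<close>, binding proof-term index 0 in \<open>u\<close>;
  \<^item> \<open>Case u A w1 B w2\<close>: \<open>u [x\<^sup>A.w1, y\<^sup>B.w2]\<close>, binding proof-term index 0 in each of \<open>w1\<close>, \<open>w2\<close>;
  \<^item> \<open>TApp u m\<close>: \<open>u m\<close> for a first-order term \<open>m\<close>;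
  \<^item> \<open>TLam u\<close>: \<open>\<lambda>\<alpha> u\<close>, binding first-order index 0 in \<open>u\<close>;
  \<^item> \<open>Wit m u\<close>: \<open>(m, u)\<close>;
  \<^item> \<open>Unpack u A t\<close>: \<open>u [(\<alpha>, x\<^sup>A).t]\<close>, binding first-order index 0 in \<open>A\<close> and \<open>t\<close>, and proof-term
    index 0 in \<open>t\<close>;
  \<^item> \<open>CDax A B\<close>: the constant \<open>\<D>\<^sup>I\<close> for \<open>I = \<forall>\<alpha>(A \<or> B) \<rightarrow> \<forall>\<alpha> A \<or> B\<close>, where \<open>A\<close> is under the
    binder \<open>\<alpha>\<close> and \<open>B\<close> is outside of it;
  \<^item> \<open>Efq p ms u\<close>: \<open>efq\<^sub>P u\<close> for the atomic formula \<open>P = p(ms)\<close>.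
\<close>

datatype ('f, 'p) pt =
    PVar nat
  | Pair "('f, 'p) pt" "('f, 'p) pt"
  | Proj0 "('f, 'p) pt"
  | Proj1 "('f, 'p) pt"
  | App "('f, 'p) pt" "('f, 'p) pt"
  | Lam "('f, 'p) fm" "('f, 'p) pt"
  | Inj0 "('f, 'p) pt"
  | Inj1 "('f, 'p) pt"
  | Case "('f, 'p) pt" "('f, 'p) fm" "('f, 'p) pt" "('f, 'p) fm" "('f, 'p) pt"
  | TApp "('f, 'p) pt" "'f trm"
  | TLam "('f, 'p) pt"
  | Wit "'f trm" "('f, 'p) pt"
  | Unpack "('f, 'p) pt" "('f, 'p) fm" "('f, 'p) pt"
  | CDax "('f, 'p) fm" "('f, 'p) fm"
  | Efq 'p "'f trm list" "('f, 'p) pt"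

text \<open>Substitution of first-order terms; it also acts on the type annotations.\<close>

fun fsubst :: "(nat \<Rightarrow> 'f trm) \<Rightarrow> ('f, 'p) pt \<Rightarrow> ('f, 'p) pt" where
  "fsubst \<sigma> (PVar n) = PVar n"
| "fsubst \<sigma> (Pair u t) = Pair (fsubst \<sigma> u) (fsubst \<sigma> t)"
| "fsubst \<sigma> (Proj0 u) = Proj0 (fsubst \<sigma> u)"
| "fsubst \<sigma> (Proj1 u) = Proj1 (fsubst \<sigma> u)"
| "fsubst \<sigma> (App t u) = App (fsubst \<sigma> t) (fsubst \<sigma> u)"
| "fsubst \<sigma> (Lam A u) = Lam (subst_fm \<sigma> A) (fsubst \<sigma> u)"
| "fsubst \<sigma> (Inj0 u) = Inj0 (fsubst \<sigma> u)"
| "fsubst \<sigma> (Inj1 u) = Inj1 (fsubst \<sigma> u)"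
| "fsubst \<sigma> (Case u A w1 B w2) =
     Case (fsubst \<sigma> u) (subst_fm \<sigma> A) (fsubst \<sigma> w1) (subst_fm \<sigma> B) (fsubst \<sigma> w2)"
| "fsubst \<sigma> (TApp u m) = TApp (fsubst \<sigma> u) (subst_trm \<sigma> m)"
| "fsubst \<sigma> (TLam u) = TLam (fsubst (up \<sigma>) u)"
| "fsubst \<sigma> (Wit m u) = Wit (subst_trm \<sigma> m) (fsubst \<sigma> u)"
| "fsubst \<sigma> (Unpack u A t) = Unpack (fsubst \<sigma> u) (subst_fm (up \<sigma>) A) (fsubst (up \<sigma>) t)"
| "fsubst \<sigma> (CDax A B) = CDax (subst_fm (up \<sigma>) A) (subst_fm \<sigma> B)"
| "fsubst \<sigma> (Efq p ms u) = Efq p (map (subst_trm \<sigma>) ms) (fsubst \<sigma> u)"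

definition upr :: "(nat \<Rightarrow> nat) \<Rightarrow> nat \<Rightarrow> nat" where
  "upr \<rho> n = (case n of 0 \<Rightarrow> 0 | Suc k \<Rightarrow> Suc (\<rho> k))"

fun pren :: "(nat \<Rightarrow> nat) \<Rightarrow> ('f, 'p) pt \<Rightarrow> ('f, 'p) pt" where
  "pren \<rho> (PVar n) = PVar (\<rho> n)"
| "pren \<rho> (Pair u t) = Pair (pren \<rho> u) (pren \<rho> t)"
| "pren \<rho> (Proj0 u) = Proj0 (pren \<rho> u)"
| "pren \<rho> (Proj1 u) = Proj1 (pren \<rho> u)"
| "pren \<rho> (App t u) = App (pren \<rho> t) (pren \<rho> u)"
| "pren \<rho> (Lam A u) = Lam A (pren (upr \<rho>) u)"
| "pren \<rho> (Inj0 u) = Inj0 (pren \<rho> u)"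
| "pren \<rho> (Inj1 u) = Inj1 (pren \<rho> u)"
| "pren \<rho> (Case u A w1 B w2) = Case (pren \<rho> u) A (pren (upr \<rho>) w1) B (pren (upr \<rho>) w2)"
| "pren \<rho> (TApp u m) = TApp (pren \<rho> u) m"
| "pren \<rho> (TLam u) = TLam (pren \<rho> u)"
| "pren \<rho> (Wit m u) = Wit m (pren \<rho> u)"
| "pren \<rho> (Unpack u A t) = Unpack (pren \<rho> u) A (pren (upr \<rho>) t)"
| "pren \<rho> (CDax A B) = CDax A B"
| "pren \<rho> (Efq p ms u) = Efq p ms (pren \<rho> u)"

text \<open>Substitution of proof terms. Passing under a first-order binder shifts the first-order
  indices of the terms being substituted.\<close>

definition upp :: "(nat \<Rightarrow> ('f, 'p) pt) \<Rightarrow> nat \<Rightarrow> ('f, 'p) pt" where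
  "upp \<theta> n = (case n of 0 \<Rightarrow> PVar 0 | Suc k \<Rightarrow> pren Suc (\<theta> k))"

definition upf :: "(nat \<Rightarrow> ('f, 'p) pt) \<Rightarrow> nat \<Rightarrow> ('f, 'p) pt" where
  "upf \<theta> n = fsubst shift (\<theta> n)"

fun psubst :: "(nat \<Rightarrow> ('f, 'p) pt) \<Rightarrow> ('f, 'p) pt \<Rightarrow> ('f, 'p) pt" where
  "psubst \<theta> (PVar n) = \<theta> n"
| "psubst \<theta> (Pair u t) = Pair (psubst \<theta> u) (psubst \<theta> t)"
| "psubst \<theta> (Proj0 u) = Proj0 (psubst \<theta> u)"
| "psubst \<theta> (Proj1 u) = Proj1 (psubst \<theta> u)"
| "psubst \<theta> (App t u) = App (psubst \<theta> t) (psubst \<theta> u)"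
| "psubst \<theta> (Lam A u) = Lam A (psubst (upp \<theta>) u)"
| "psubst \<theta> (Inj0 u) = Inj0 (psubst \<theta> u)"
| "psubst \<theta> (Inj1 u) = Inj1 (psubst \<theta> u)"
| "psubst \<theta> (Case u A w1 B w2) = Case (psubst \<theta> u) A (psubst (upp \<theta>) w1) B (psubst (upp \<theta>) w2)"
| "psubst \<theta> (TApp u m) = TApp (psubst \<theta> u) m"
| "psubst \<theta> (TLam u) = TLam (psubst (upf \<theta>) u)"
| "psubst \<theta> (Wit m u) = Wit m (psubst \<theta> u)"
| "psubst \<theta> (Unpack u A t) = Unpack (psubst \<theta> u) A (psubst (upp (upf \<theta>)) t)"
| "psubst \<theta> (CDax A B) = CDax A B"
| "psubst \<theta> (Efq p ms u) = Efq p ms (psubst \<theta> u)"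

definition pinst :: "('f, 'p) pt \<Rightarrow> ('f, 'p) pt \<Rightarrow> ('f, 'p) pt" where
  "pinst t u = psubst (\<lambda>n. case n of 0 \<Rightarrow> t | Suc k \<Rightarrow> PVar k) u"

text \<open>
  \<open>typed L \<Gamma> t A\<close>: the proof term \<open>t\<close> over \<open>L\<close> has type \<open>A\<close>, where the free proof-term variable
  with index \<open>i\<close> has type \<open>\<Gamma> ! i\<close>. The eigenvariable conditions of \<open>\<forall>\<close>-introduction and
  \<open>\<exists>\<close>-elimination are expressed by shifting: the types of the variables free in \<open>TLam u\<close>, and the
  type \<open>C\<close> of an \<open>Unpack\<close>, live outside the binder and so cannot mention the bound index 0.
\<close>

inductive typed ::
  "('f, 'p) lang \<Rightarrow> ('f, 'p) fm list \<Rightarrow> ('f, 'p) pt \<Rightarrow> ('f, 'p) fm \<Rightarrow> bool" for L where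
  Ax: "i < length \<Gamma> \<Longrightarrow> wf_fm L (\<Gamma> ! i) \<Longrightarrow> typed L \<Gamma> (PVar i) (\<Gamma> ! i)"
| AndI: "typed L \<Gamma> u A \<Longrightarrow> typed L \<Gamma> t B \<Longrightarrow> typed L \<Gamma> (Pair u t) (And A B)"
| AndE0: "typed L \<Gamma> u (And A B) \<Longrightarrow> typed L \<Gamma> (Proj0 u) A"
| AndE1: "typed L \<Gamma> u (And A B) \<Longrightarrow> typed L \<Gamma> (Proj1 u) B"
| ImpE: "typed L \<Gamma> t (Imp A B) \<Longrightarrow> typed L \<Gamma> u A \<Longrightarrow> typed L \<Gamma> (App t u) B"
| ImpI: "wf_fm L A \<Longrightarrow> typed L (A # \<Gamma>) u B \<Longrightarrow> typed L \<Gamma> (Lam A u) (Imp A B)"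
| OrI0: "typed L \<Gamma> u A \<Longrightarrow> wf_fm L B \<Longrightarrow> typed L \<Gamma> (Inj0 u) (Or A B)"
| OrI1: "wf_fm L A \<Longrightarrow> typed L \<Gamma> u B \<Longrightarrow> typed L \<Gamma> (Inj1 u) (Or A B)"
| OrE: "typed L \<Gamma> u (Or A B) \<Longrightarrow> typed L (A # \<Gamma>) w1 C \<Longrightarrow> typed L (B # \<Gamma>) w2 C \<Longrightarrow>
    typed L \<Gamma> (Case u A w1 B w2) C"
| AllE: "typed L \<Gamma> u (Forall A) \<Longrightarrow> wf_trm L m \<Longrightarrow> typed L \<Gamma> (TApp u m) (inst_fm m A)"
| AllI: "typed L (map shift_fm \<Gamma>) u A \<Longrightarrow> typed L \<Gamma> (TLam u) (Forall A)"
| ExI: "wf_trm L m \<Longrightarrow> typed L \<Gamma> u (inst_fm m A) \<Longrightarrow> typed L \<Gamma> (Wit m u) (Exists A)"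
| ExE: "typed L \<Gamma> u (Exists A) \<Longrightarrow> typed L (A # map shift_fm \<Gamma>) t (shift_fm C) \<Longrightarrow>
    typed L \<Gamma> (Unpack u A t) C"
| CD: "wf_fm L A \<Longrightarrow> wf_fm L B \<Longrightarrow>
    typed L \<Gamma> (CDax A B) (Imp (Forall (Or A (shift_fm B))) (Or (Forall A) B))"
| ExFalso: "typed L \<Gamma> u (Falsum L) \<Longrightarrow> wf_fm L (Atom p ms) \<Longrightarrow>
    typed L \<Gamma> (Efq p ms u) (Atom p ms)"

text \<open>Free first-order variables are allowed in \<open>t\<close> and \<open>A\<close>.\<close>

definition CD_proves :: "('f, 'p) lang \<Rightarrow> ('f, 'p) pt \<Rightarrow> ('f, 'p) fm \<Rightarrow> bool" where
  "CD_proves L t A \<longleftrightarrow> typed L [] t A"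

inductive red :: "('f, 'p) lang \<Rightarrow> ('f, 'p) pt \<Rightarrow> ('f, 'p) pt \<Rightarrow> bool" for L where
  beta: "red L (App (Lam A u) t) (pinst t u)"
| tbeta: "wf_trm L m \<Longrightarrow> red L (TApp (TLam u) m) (fsubst (inst m) u)"
| proj0: "red L (Proj0 (Pair u0 u1)) u0"
| proj1: "red L (Proj1 (Pair u0 u1)) u1"
| case0: "red L (Case (Inj0 u) A t0 B t1) (pinst u t0)"
| case1: "red L (Case (Inj1 u) A t0 B t1) (pinst u t1)"
| unpack: "wf_trm L m \<Longrightarrow> red L (Unpack (Wit m u) A v) (pinst u (fsubst (inst m) v))"
| cd0: "red L (App (CDax A B) (TLam (Inj0 u))) (Inj0 (TLam u))"
| cd1: "red L (App (CDax A B) (TLam (Inj1 u))) (Inj1 (fsubst (inst (Zero L)) u))"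
| Pair_l: "red L u u' \<Longrightarrow> red L (Pair u t) (Pair u' t)"
| Pair_r: "red L t t' \<Longrightarrow> red L (Pair u t) (Pair u t')"
| Proj0_c: "red L u u' \<Longrightarrow> red L (Proj0 u) (Proj0 u')"
| Proj1_c: "red L u u' \<Longrightarrow> red L (Proj1 u) (Proj1 u')"
| App_l: "red L t t' \<Longrightarrow> red L (App t u) (App t' u)"
| App_r: "red L u u' \<Longrightarrow> red L (App t u) (App t u')"
| Lam_c: "red L u u' \<Longrightarrow> red L (Lam A u) (Lam A u')"
| Inj0_c: "red L u u' \<Longrightarrow> red L (Inj0 u) (Inj0 u')"
| Inj1_c: "red L u u' \<Longrightarrow> red L (Inj1 u) (Inj1 u')"
| Case_c: "red L u u' \<Longrightarrow> red L (Case u A w1 B w2) (Case u' A w1 B w2)"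
| Case_l: "red L w1 w1' \<Longrightarrow> red L (Case u A w1 B w2) (Case u A w1' B w2)"
| Case_r: "red L w2 w2' \<Longrightarrow> red L (Case u A w1 B w2) (Case u A w1 B w2')"
| TApp_c: "red L u u' \<Longrightarrow> red L (TApp u m) (TApp u' m)"
| TLam_c: "red L u u' \<Longrightarrow> red L (TLam u) (TLam u')"
| Wit_c: "red L u u' \<Longrightarrow> red L (Wit m u) (Wit m u')"
| Unpack_l: "red L u u' \<Longrightarrow> red L (Unpack u A t) (Unpack u' A t)"
| Unpack_r: "red L t t' \<Longrightarrow> red L (Unpack u A t) (Unpack u A t')"
| Efq_c: "red L u u' \<Longrightarrow> red L (Efq p ms u) (Efq p ms u')"

definition normal :: "('f, 'p) lang \<Rightarrow> ('f, 'p) pt \<Rightarrow> bool" where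
  "normal L t \<longleftrightarrow> \<not> (\<exists>u. red L t u)"

end

theory Submission
  imports Defs
begin

text \<open>
  A normal proof term without free proof-term variables ends with an introduction or is a
  constant-domain axiom. This is an induction on the typing derivation: if the last rule is an
  elimination, its major premise is again closed and normal, so it is an introduction or an axiom,
  and its type makes it form a redex with the elimination. Two points are special to \<open>CD\<close>.
  \<^item> An axiom \<open>\<D>\<close> of type \<open>\<forall>\<alpha>(A \<or> B) \<rightarrow> \<forall>\<alpha> A \<or> B\<close>, applied to \<open>u\<close>, reduces only if \<open>u\<close> has the form
    \<open>\<lambda>\<alpha> \<iota>\<^sub>i(v)\<close>. Closedness refers to proof-term variables alone, so the body of a closed \<open>\<lambda>\<alpha> w\<close> is
    closed although \<open>\<alpha>\<close> may be free in it; by induction \<open>w\<close> is thus an injection. The predicate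
    \<open>canonical\<close> therefore looks through leading first-order abstractions.
  \<^item> No introduction or axiom has an atomic type. Hence \<open>\<bottom>\<close> has no closed normal proof,
    and the ex falso rule does not occur last.

  The three claims then follow by inverting the typing rules.
\<close>

text \<open>Terms that, below any leading abstractions over first-order variables, are introductions or
  constant-domain axioms.\<close>

fun canonical :: "('f, 'p) pt \<Rightarrow> bool" where
  "canonical (Pair u t) \<longleftrightarrow> True"
| "canonical (Lam A u) \<longleftrightarrow> True"
| "canonical (Inj0 u) \<longleftrightarrow> True"
| "canonical (Inj1 u) \<longleftrightarrow> True"
| "canonical (TLam u) \<longleftrightarrow> canonical u"
| "canonical (Wit m u) \<longleftrightarrow> True"
| "canonical (CDax A B) \<longleftrightarrow> True"
| "canonical _ \<longleftrightarrow> False"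

lemma canonical_Atom: "typed L \<Gamma> t (Atom p ms) \<Longrightarrow> \<not> canonical t"
  by (auto elim: typed.cases)

lemma canonical_AndE:
  assumes "typed L \<Gamma> t (And A B)" and "canonical t"
  obtains u v where "t = Pair u v"
  using assms by (auto elim: typed.cases)

lemma canonical_ImpE:
  assumes "typed L \<Gamma> t (Imp A B)" and "canonical t"
  obtains u where "t = Lam A u"
  | C D where "t = CDax C D" "A = Forall (Or C (shift_fm D))"
  using assms by (auto elim: typed.cases)

lemma canonical_OrE:
  assumes "typed L \<Gamma> t (Or A B)" and "canonical t"
  obtains u where "t = Inj0 u" "typed L \<Gamma> u A" | u where "t = Inj1 u" "typed L \<Gamma> u B"
  using assms by (auto elim: typed.cases)

lemma canonical_ForallE:
  assumes "typed L \<Gamma> t (Forall A)" and "canonical t"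
  obtains u where "t = TLam u" "typed L (map shift_fm \<Gamma>) u A" "canonical u"
  using assms by (auto elim: typed.cases)

lemma canonical_ExistsE:
  assumes "typed L \<Gamma> t (Exists A)" and "canonical t"
  obtains m u where "t = Wit m u" "wf_trm L m" "typed L \<Gamma> u (inst_fm m A)"
  using assms by (auto elim: typed.cases)

theorem closed_normal_canonical:
  assumes "typed L [] t A" and "normal L t"
  shows "canonical t"
proof -
  have "canonical t" if "typed L \<Gamma> t A" "\<Gamma> = []" "normal L t" for \<Gamma>
    using that
  proof (induction rule: typed.induct)
    case (AndE0 \<Gamma> u A B)
    then have "canonical u" by (auto simp: normal_def intro: red.intros)
    with AndE0.hyps obtain v w where "u = Pair v w" by (rule canonical_AndE)
    with AndE0.prems show ?case by (auto simp: normal_def intro: red.intros)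
  next
    case (AndE1 \<Gamma> u A B)
    then have "canonical u" by (auto simp: normal_def intro: red.intros)
    with AndE1.hyps obtain v w where "u = Pair v w" by (rule canonical_AndE)
    with AndE1.prems show ?case by (auto simp: normal_def intro: red.intros)
  next
    case (ImpE \<Gamma> t A B u)
    then have "canonical t" by (auto simp: normal_def intro: red.intros)
    with ImpE.hyps(1) show ?case
    proof (cases rule: canonical_ImpE)
      case (1 v)
      with ImpE.prems show ?thesis by (auto simp: normal_def intro: red.intros)
    next
      case (2 C D)
      from ImpE have "canonical u" by (auto simp: normal_def intro: red.intros)
      with ImpE.hyps(2) 2 obtain w
        where w: "u = TLam w" "typed L (map shift_fm \<Gamma>) w (Or C (shift_fm D))" "canonical w"
        by (auto elim: canonical_ForallE)
      from w(2,3) obtain v where "w = Inj0 v \<or> w = Inj1 v" by (auto elim: canonical_OrE)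
      with 2 w(1) ImpE.prems show ?thesis by (auto simp: normal_def intro: red.intros)
    qed
  next
    case (OrE \<Gamma> u A B w1 C w2)
    then have "canonical u" by (auto simp: normal_def intro: red.intros)
    with OrE.hyps(1) obtain v where "u = Inj0 v \<or> u = Inj1 v" by (auto elim: canonical_OrE)
    with OrE.prems show ?case by (auto simp: normal_def intro: red.intros)
  next
    case (AllE \<Gamma> u A m)
    then have "canonical u" by (auto simp: normal_def intro: red.intros)
    with AllE.hyps(1) obtain v where "u = TLam v" by (rule canonical_ForallE)
    with AllE.hyps(2) AllE.prems show ?case by (auto simp: normal_def intro: red.intros)
  next
    case (AllI \<Gamma> u A)
    then show ?case by (auto simp: normal_def intro: red.intros)
  next
    case (ExE \<Gamma> u A t C)
    then have "canonical u" by (auto simp: normal_def intro: red.intros)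
    with ExE.hyps(1) obtain m v where "u = Wit m v" "wf_trm L m" by (rule canonical_ExistsE)
    with ExE.prems show ?case by (auto simp: normal_def intro: red.intros)
  next
    case (ExFalso \<Gamma> u p ms)
    then have "canonical u" by (auto simp: normal_def intro: red.intros)
    with canonical_Atom [OF ExFalso.hyps(1)] show ?case by simp
  qed auto
  with assms show ?thesis by blast
qed

theorem theorem2:
  fixes L :: "('f, 'p::countable) lang"
  assumes "language L"
  shows
   "(\<forall>A t. CD_proves L t (Exists A) \<and> normal L t \<longrightarrow>
       (\<exists>m u. wf_trm L m \<and> t = Wit m u \<and> CD_proves L u (inst_fm m A)))
  \<and> (\<forall>A B t. CD_proves L t (Or A B) \<and> normal L t \<longrightarrow>
       (\<exists>u. (t = Inj0 u \<and> CD_proves L u A) \<or> (t = Inj1 u \<and> CD_proves L u B)))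
  \<and> (\<forall>A t. CD_proves L t (Forall A) \<and> normal L t \<longrightarrow>
       (\<exists>u. t = TLam u \<and> CD_proves L u A))"
  unfolding CD_proves_def
proof (intro conjI allI impI; elim conjE)
  fix A and t :: "('f, 'p) pt"
  assume t: "typed L [] t (Exists A)" and "normal L t"
  then have "canonical t" by (rule closed_normal_canonical)
  with t show "\<exists>m u. wf_trm L m \<and> t = Wit m u \<and> typed L [] u (inst_fm m A)"
    by (rule canonical_ExistsE) blast
next
  fix A B and t :: "('f, 'p) pt"
  assume t: "typed L [] t (Or A B)" and "normal L t"
  then have "canonical t" by (rule closed_normal_canonical)
  with t show "\<exists>u. (t = Inj0 u \<and> typed L [] u A) \<or> (t = Inj1 u \<and> typed L [] u B)"
    by (rule canonical_OrE) blast+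
next
  fix A and t :: "('f, 'p) pt"
  assume t: "typed L [] t (Forall A)" and "normal L t"
  then have "canonical t" by (rule closed_normal_canonical)
  with t show "\<exists>u. t = TLam u \<and> typed L [] u A"
    by (rule canonical_ForallE) simp
qed

end
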